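(* Let $\mathcal{S}\in\mathbb{C}^{p\times q\times n}$ and $\mathcal{T}\in\mathbb{C}^{q\times k\times n}$, and let $(\mathcal{S}*\mathcal{T})^{(1)}$ be an arbitrary fixed element of $(\mathcal{S}*\mathcal{T})\{1\}$. Assume that the following conditions hold: (a) there exists $\mathcal{X}\in\mathbb{C}^{q\times p\times n}$ with $\mathcal{X}*\mathcal{S}*\mathcal{X}=\mathcal{X}$ and $\mathscr{R}(\mathcal{X})=\mathscr{R}(\mathcal{T})$; (b) $\mathcal{T}=\mathcal{T}*\mathcal{Z}*\mathcal{S}*\mathcal{T}$ for some $\mathcal{Z}\in\mathbb{C}^{k\times p\times n}$; (c) $\mathscr{N}(\mathcal{T})=\mathscr{N}(\mathcal{S}*\mathcal{T})$; (d) $\mathcal{T}=\mathcal{T}*(\mathcal{S}*\mathcal{T})^{(1)}*\mathcal{S}*\mathcal{T}$; (e) $\mathrm{rank}_t(\mathcal{S}*\mathcal{T})=\mathrm{rank}_t(\mathcal{T})$. Then the set $\mathcal{S}\{2\}_{\mathscr{R}(\mathcal{T}),*}$ has the following representations: (i) $\mathcal{S}\{2\}_{\mathscr{R}(\mathcal{T}),*}=\{\mathcal{T}*\mathcal{Y} : \mathcal{Y}\in(\mathcal{S}*\mathcal{T})\{1\}\}=\{\mathcal{T}*\mathcal{Z} : \mathcal{Z}\in\mathbb{C}^{k\times p\times n},\ \mathcal{T}*\mathcal{Z}*\mathcal{S}*\mathcal{T}=\mathcal{T}\}$. (ii) $\mathcal{S}\{2\}_{\mathscr{R}(\mathcal{T}),*}=\{\mathcal{T}*(\mathcal{S}*\mathcal{T})^{(1)}+\mathcal{T}*\mathcal{Z}-\mathcal{T}*\mathcal{Z}*\mathcal{S}*\mathcal{T}*(\mathcal{S}*\mathcal{T})^{(1)}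 : \mathcal{Z}\in\mathbb{C}^{k\times p\times n}\}$.
   Context: A third-order tensor $\mathcal{A}\in\mathbb{C}^{a\times b\times n}$ has frontal slices $A_1,\dots,A_n\in\mathbb{C}^{a\times b}$, $A_k=\mathcal{A}(:,:,k)$. $\mathrm{bcirc}(\mathcal{A})\in\mathbb{C}^{an\times bn}$ is the block circulant matrix whose $(i,j)$ block ($1\le i,j\le n$) is $A_{((i-j)\bmod n)+1}$. For $\mathcal{A}\in\mathbb{C}^{a\times b\times n}$ and $\mathcal{B}\in\mathbb{C}^{b\times c\times n}$, the $t$-product $\mathcal{A}*\mathcal{B}\in\mathbb{C}^{a\times c\times n}$ is the unique tensor with $\mathrm{bcirc}(\mathcal{A}*\mathcal{B})=\mathrm{bcirc}(\mathcal{A})\,\mathrm{bcirc}(\mathcal{B})$. The $t$-range space $\mathscr{R}(\mathcal{A})$ is the range (column space) of $\mathrm{bcirc}(\mathcal{A})$, the $t$-null space $\mathscr{N}(\mathcal{A})$ is the null space of $\mathrm{bcirc}(\mathcal{A})$, and $\mathrm{rank}_t(\mathcal{A})=\mathrm{rank}(\mathrm{bcirc}(\mathcal{A}))$. For $\mathcal{A}\in\mathbb{C}^{a\times b\times n}$, $\mathcal{A}\{1\}$ is the set of $\mathcal{X}\in\mathbb{C}^{b\times a\times n}$ with $\mathcal{A}*\mathcal{X}*\mathcal{A}=\mathcal{A}$. The set $\mathcal{S}\{2\}_{\mathscr{R}(\mathcal{T}),*}$ consists of all $\mathcal{X}\in\mathbb{C}^{q\times p\times n}$ with $\mathcal{X}*\mathcal{S}*\mathcal{X}=\mathcal{X}$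 and $\mathscr{R}(\mathcal{X})=\mathscr{R}(\mathcal{T})$. *)

theory Defs
  imports Complex_Main "HOL-Number_Theory.Cong"
    "Jordan_Normal_Form.Matrix_Kernel" "Jordan_Normal_Form.DL_Rank"
begin

text \<open>
  A third-order tensor is the list of its frontal slices, so slice number \<open>k\<close> (counted from 1)
  is \<open>A ! (k - 1)\<close>. The set below renders the tensors of size \<open>a\<close> by \<open>b\<close> by \<open>n\<close>; for \<open>n > 0\<close> the
  size can be read off from the list.
\<close>

type_synonym tensor = "complex mat list"

definition tensors :: "nat \<Rightarrow> nat \<Rightarrow> nat \<Rightarrow> tensor set" where
  "tensors a b n = {A. length A = n \<and> set A \<subseteq> carrier_mat a b}"

definition trows :: "tensor \<Rightarrow> nat" where
  "trows A = dim_row (hd A)"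

definition tcols :: "tensor \<Rightarrow> nat" where
  "tcols A = dim_col (hd A)"

text \<open>
  Rows, columns and blocks are counted from 0, so block \<open>(i, j)\<close> is the slice with list index
  \<open>(i - j) mod n\<close>, the difference being taken in the integers.
\<close>

definition bcirc :: "tensor \<Rightarrow> complex mat" where
  "bcirc A = (let a = trows A; b = tcols A; n = length A in
     mat (a * n) (b * n) (\<lambda>(i, j).
       (A ! nat ((int (i div a) - int (j div b)) mod int n)) $$ (i mod a, j mod b)))"

text \<open>Unique existence is shown in \<open>tprod_ex1\<close> for factors of matching sizes.\<close>

definition tprod :: "tensor \<Rightarrow> tensor \<Rightarrow> tensor" (infixl \<open>*\<^sub>t\<close> 70) where
  "A *\<^sub>t B = (THE C. C \<in> tensors (trows A) (tcols B) (length A) \<and> bcirc C = bcirc A * bcirc B)"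

definition tplus :: "tensor \<Rightarrow> tensor \<Rightarrow> tensor" (infixl \<open>+\<^sub>t\<close> 65) where
  "A +\<^sub>t B = map2 (+) A B"

definition tminus :: "tensor \<Rightarrow> tensor \<Rightarrow> tensor" (infixl \<open>-\<^sub>t\<close> 65) where
  "A -\<^sub>t B = map2 (-) A B"

definition trange :: "tensor \<Rightarrow> complex vec set" where
  "trange A = vec_space.col_space (dim_row (bcirc A)) (bcirc A)"

definition tnull :: "tensor \<Rightarrow> complex vec set" where
  "tnull A = mat_kernel (bcirc A)"

definition trank :: "tensor \<Rightarrow> nat" where
  "trank A = vec_space.rank (dim_row (bcirc A)) (bcirc A)"

definition inverses_1 :: "tensor \<Rightarrow> tensor set" where
  "inverses_1 A = {X \<in> tensors (tcols A) (trows A) (length A). A *\<^sub>t X *\<^sub>t A = A}"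

definition inverses_2_range :: "tensor \<Rightarrow> tensor \<Rightarrow> tensor set" where
  "inverses_2_range S T =
     {X \<in> tensors (tcols S) (trows S) (length S). X *\<^sub>t S *\<^sub>t X = X \<and> trange X = trange T}"

lemma tensors_nth: "A \<in> tensors a b n \<Longrightarrow> k < n \<Longrightarrow> A ! k \<in> carrier_mat a b"
  unfolding tensors_def by (auto dest: nth_mem)

lemma tensors_size:
  assumes "A \<in> tensors a b n" "0 < n"
  shows "length A = n" "trows A = a" "tcols A = b"
proof -
  show l: "length A = n" using assms by (simp add: tensors_def)
  have "hd A = A ! 0" using l assms(2) by (intro hd_conv_nth) auto
  then show "trows A = a" "tcols A = b"
    using tensors_nth[OF assms(1,2)] by (auto simp: trows_def tcols_def)
qed

lemma bcirc_carrier: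
  assumes "A \<in> tensors a b n" "0 < n"
  shows "bcirc A \<in> carrier_mat (a * n) (b * n)"
  using tensors_size[OF assms] by (simp add: bcirc_def Let_def)

lemma bcirc_index:
  assumes "A \<in> tensors a b n" "0 < n" "i < a * n" "j < b * n"
  shows "bcirc A $$ (i, j) =
    (A ! nat ((int (i div a) - int (j div b)) mod int n)) $$ (i mod a, j mod b)"
  using tensors_size[OF assms(1,2)] assms(3,4) by (simp add: bcirc_def Let_def)

lemma bcirc_inj:
  assumes A: "A \<in> tensors a b n" and B: "B \<in> tensors a b n" and n: "0 < n"
    and eq: "bcirc A = bcirc B"
  shows "A = B"
proof (rule nth_equalityI)
  show "length A = length B" using tensors_size[OF A n] tensors_size[OF B n] by simp
  fix k assume "k < length A"
  then have k: "k < n" using tensors_size[OF A n] by simp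
  show "A ! k = B ! k"
  proof (rule eq_matI)
    fix r s assume "r < dim_row (B ! k)" "s < dim_col (B ! k)"
    then have r: "r < a" and s: "s < b" using tensors_nth[OF B k] by auto
    have "k * a + r < Suc k * a" using r by simp
    also have "\<dots> \<le> n * a" using k by (intro mult_le_mono1) simp
    finally have i: "k * a + r < a * n" by (simp add: mult.commute)
    have "s < b * 1" using s by simp
    also have "\<dots> \<le> b * n" using n by (intro mult_le_mono2) simp
    finally have j: "s < b * n" .
    show "A ! k $$ (r, s) = B ! k $$ (r, s)"
      using arg_cong[OF eq, of "\<lambda>M. M $$ (k * a + r, s)"] r s k
      by (simp add: bcirc_index[OF A n i j] bcirc_index[OF B n i j])
  qed (use tensors_nth[OF A k] tensors_nth[OF B k] in auto)
qed

lemma tprod_ex1: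
  assumes A: "A \<in> tensors a b n" and B: "B \<in> tensors b c n" and n: "0 < n"
  shows "\<exists>!C. C \<in> tensors a c n \<and> bcirc C = bcirc A * bcirc B"
proof (rule ex_ex1I)
  define P where "P = bcirc A * bcirc B"
  note cA = bcirc_carrier[OF A n] and cB = bcirc_carrier[OF B n]
  have P: "P \<in> carrier_mat (a * n) (c * n)" using cA cB by (simp add: P_def)
  define g where "g i j l =
      (A ! nat ((int (i div a) - int (l div b)) mod int n)) $$ (i mod a, l mod b) *
      (B ! nat ((int (l div b) - int (j div c)) mod int n)) $$ (l mod b, j mod c)" for i j l
  have P_index: "P $$ (i, j) = (\<Sum>l<b * n. g i j l)" if "i < a * n" "j < c * n" for i j
  proof -
    have "P $$ (i, j) = (\<Sum>l<b * n. bcirc A $$ (i, l) * bcirc B $$ (l, j))"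
      using that cA cB by (simp add: P_def scalar_prod_def atLeast0LessThan)
    also have "\<dots> = (\<Sum>l<b * n. g i j l)"
      using that by (intro sum.cong) (simp_all add: bcirc_index[OF A n] bcirc_index[OF B n] g_def)
    finally show ?thesis .
  qed
  define C where "C = map (\<lambda>k. mat a c (\<lambda>(r, s). P $$ (k * a + r, s))) [0..<n]"
  have C: "C \<in> tensors a c n" by (auto simp: C_def tensors_def)
  have "bcirc C = P"
  proof (rule eq_matI)
    fix i j assume "i < dim_row P" "j < dim_col P"
    then have i: "i < a * n" and j: "j < c * n" using P by auto
    have a0: "0 < a" and c0: "0 < c" using i j by (auto intro: gr0I)
    have jn: "j div c < n" using j by (simp add: less_mult_imp_div_less mult.commute)
    define k where "k = nat ((int (i div a) - int (j div c)) mod int n)"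
    have kint: "int k = (int (i div a) - int (j div c)) mod int n"
      using n by (simp add: k_def)
    have k: "k < n" using n by (simp add: k_def nat_less_iff)
    have "k * a + i mod a < Suc k * a" using a0 by simp
    also have "\<dots> \<le> n * a" using k by (intro mult_le_mono1) simp
    finally have i': "k * a + i mod a < a * n" by (simp add: mult.commute)
    have "j mod c < c * 1" using c0 by simp
    also have "\<dots> \<le> c * n" using n by (intro mult_le_mono2) simp
    finally have j': "j mod c < c * n" .
    define f where "f l = (l + (j div c) * b) mod (b * n)" for l
    have f_inj: "inj_on f {..<b * n}"
    proof (rule inj_onI)
      fix x y assume "x \<in> {..<b * n}" "y \<in> {..<b * n}" "f x = f y"
      then show "x = y"
        using cong_add_rcancel_nat[of x "(j div c) * b" y "b * n"]
        by (auto simp: cong_def f_def)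
    qed
    have "f ` {..<b * n} \<subseteq> {..<b * n}" by (auto simp: f_def intro!: mod_less_divisor gr0I)
    then have f_bij: "bij_betw f {..<b * n} {..<b * n}"
      using f_inj by (simp add: bij_betw_def endo_inj_surj)
    have g_f: "g i j (f l) = g (k * a + i mod a) (j mod c) l" if l: "l < b * n" for l
    proof -
      have b0: "0 < b" using l by (auto intro: gr0I)
      have fm: "f l mod b = l mod b" by (simp add: f_def mod_mult2_eq)
      have fd: "f l div b = (l div b + j div c) mod n"
        using b0 by (simp add: f_def mod_mult2_eq add.commute)
      have ln: "l div b < n" using l by (simp add: less_mult_imp_div_less mult.commute)
      have e1: "(int (i div a) - int (f l div b)) mod int n = (int k - int (l div b)) mod int n"
        unfolding fd kint of_nat_mod of_nat_add mod_simps by (simp add: algebra_simps)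
      have e2: "(int (f l div b) - int (j div c)) mod int n = int (l div b) mod int n"
        unfolding fd of_nat_mod of_nat_add mod_simps by simp
      show ?thesis using a0 c0 by (simp add: g_def fm e1 e2)
    qed
    have "bcirc C $$ (i, j) = P $$ (k * a + i mod a, j mod c)"
      using a0 c0 k by (simp add: bcirc_index[OF C n i j] k_def[symmetric]) (simp add: C_def)
    also have "\<dots> = (\<Sum>l<b * n. g i j (f l))"
      by (simp add: P_index[OF i' j'] g_f)
    also have "\<dots> = (\<Sum>l<b * n. g i j l)"
      by (rule sum.reindex_bij_betw[OF f_bij])
    finally show "bcirc C $$ (i, j) = P $$ (i, j)" by (simp add: P_index[OF i j])
  qed (use P bcirc_carrier[OF C n] in auto)
  then show "\<exists>C. C \<in> tensors a c n \<and> bcirc C = bcirc A * bcirc B"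
    using C by (auto simp: P_def)
qed (use bcirc_inj n in auto)

lemma tprod_works:
  assumes "A \<in> tensors a b n" "B \<in> tensors b c n" "0 < n"
  shows "A *\<^sub>t B \<in> tensors a c n" "bcirc (A *\<^sub>t B) = bcirc A * bcirc B"
  using theI'[OF tprod_ex1[OF assms]] tensors_size[OF assms(1,3)] tensors_size[OF assms(2,3)]
  by (simp_all add: tprod_def)

end

theory Submission
  imports Defs
begin

text \<open>
  A tensor \<open>X\<close> is a \<open>{2}\<close>-inverse of \<open>S\<close> with the range of \<open>T\<close> exactly when \<open>X * S\<close> fixes \<open>T\<close> and
  the range of \<open>X\<close> lies inside that of \<open>T\<close> (\<open>inverses_2_range_iff\<close>).  The reason is that a left
  factor which fixes \<open>T\<close> fixes every tensor whose range lies in that of \<open>T\<close>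
  (\<open>tprod_left_fix_range\<close>): the equations \<open>X * S * X = X\<close> and \<open>X * S * T = T\<close> say that \<open>X * S\<close> is
  the identity on the range of \<open>X\<close> and on the range of \<open>T\<close>, and these two ranges agree.

  Condition (d) makes \<open>T * G * S\<close> one such left factor.  So a tensor \<open>X\<close> with range inside that of \<open>T\<close>
  equals \<open>T * (G * S * X)\<close>, an explicit factorization through \<open>T\<close> by a tensor, and the set in question
  consists of the tensors \<open>T * Z\<close> with \<open>T * Z * S * T = T\<close>.  This is a linear equation for \<open>Z\<close>.  By
  (d) it has the same solutions as the equation \<open>S * T * Z * S * T = S * T\<close> that defines the
  \<open>{1}\<close>-inverses of \<open>S * T\<close>.  The tensor \<open>G\<close> is a particular solution, and \<open>Z - Z * S * T * G\<close> solves
  the homogeneous equation for every \<open>Z\<close>; every solution \<open>Z\<close> arises from these two as a sum, up to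
  a term that \<open>T\<close> annihilates, which gives the parametrization (ii).

  The algebraic laws of the t-product are those of matrices, pulled back along the injective
  map \<open>bcirc\<close>.
\<close>

section \<open>Algebra of tensors\<close>

lemma tprod_assoc:
  assumes A: "A \<in> tensors a b n" and B: "B \<in> tensors b c n" and C: "C \<in> tensors c d n"
    and n: "0 < n"
  shows "A *\<^sub>t B *\<^sub>t C = A *\<^sub>t (B *\<^sub>t C)"
proof (rule bcirc_inj[OF _ _ n])
  note AB = tprod_works[OF A B n] and BC = tprod_works[OF B C n]
  show "A *\<^sub>t B *\<^sub>t C \<in> tensors a d n" by (rule tprod_works(1)[OF AB(1) C n])
  show "A *\<^sub>t (B *\<^sub>t C) \<in> tensors a d n" by (rule tprod_works(1)[OF A BC(1) n])
  show "bcirc (A *\<^sub>t B *\<^sub>t C) = bcirc (A *\<^sub>t (B *\<^sub>t C))"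
    using bcirc_carrier[OF A n] bcirc_carrier[OF B n] bcirc_carrier[OF C n]
    by (simp add: tprod_works(2)[OF AB(1) C n] tprod_works(2)[OF A BC(1) n] AB(2) BC(2))
qed

lemma tplus_closed:
  assumes "A \<in> tensors a b n" "B \<in> tensors a b n"
  shows "A +\<^sub>t B \<in> tensors a b n"
  using assms by (auto simp: tensors_def tplus_def dest!: set_zip_rightD)

lemma tminus_closed:
  assumes "A \<in> tensors a b n" "B \<in> tensors a b n"
  shows "A -\<^sub>t B \<in> tensors a b n"
  using assms by (auto simp: tensors_def tminus_def dest!: set_zip_rightD intro!: minus_carrier_mat)

lemma bcirc_slice_bounds:
  fixes a b n i j :: nat
  assumes "i < a * n" "j < b * n"
  shows "nat ((int (i div a) - int (j div b)) mod int n) < n" "i mod a < a" "j mod b < b"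
proof -
  have "0 < n" "0 < a" "0 < b" using assms by (auto intro: gr0I)
  then show "nat ((int (i div a) - int (j div b)) mod int n) < n" "i mod a < a" "j mod b < b"
    by (simp_all add: nat_less_iff)
qed

lemma bcirc_tplus:
  assumes A: "A \<in> tensors a b n" and B: "B \<in> tensors a b n" and n: "0 < n"
  shows "bcirc (A +\<^sub>t B) = bcirc A + bcirc B"
proof (rule eq_matI)
  note C = tplus_closed[OF A B]
  fix i j assume "i < dim_row (bcirc A + bcirc B)" "j < dim_col (bcirc A + bcirc B)"
  then have i: "i < a * n" and j: "j < b * n" using bcirc_carrier[OF B n] by auto
  note bd = bcirc_slice_bounds[OF i j]
  show "bcirc (A +\<^sub>t B) $$ (i, j) = (bcirc A + bcirc B) $$ (i, j)"
    using i j bd tensors_nth[OF B bd(1)] bcirc_carrier[OF B n]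
      tensors_size(1)[OF A n] tensors_size(1)[OF B n]
    by (simp add: bcirc_index[OF C n] bcirc_index[OF A n] bcirc_index[OF B n])
      (simp add: tplus_def)
qed (use bcirc_carrier[OF tplus_closed[OF A B] n] bcirc_carrier[OF B n] in auto)

lemma bcirc_tminus:
  assumes A: "A \<in> tensors a b n" and B: "B \<in> tensors a b n" and n: "0 < n"
  shows "bcirc (A -\<^sub>t B) = bcirc A - bcirc B"
proof (rule eq_matI)
  note C = tminus_closed[OF A B]
  fix i j assume "i < dim_row (bcirc A - bcirc B)" "j < dim_col (bcirc A - bcirc B)"
  then have i: "i < a * n" and j: "j < b * n" using bcirc_carrier[OF B n] by auto
  note bd = bcirc_slice_bounds[OF i j]
  show "bcirc (A -\<^sub>t B) $$ (i, j) = (bcirc A - bcirc B) $$ (i, j)"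
    using i j bd tensors_nth[OF B bd(1)] bcirc_carrier[OF B n]
      tensors_size(1)[OF A n] tensors_size(1)[OF B n]
    by (simp add: bcirc_index[OF C n] bcirc_index[OF A n] bcirc_index[OF B n])
      (simp add: tminus_def)
qed (use bcirc_carrier[OF tminus_closed[OF A B] n] bcirc_carrier[OF B n] in auto)

lemma tprod_tplus_tminus_left:
  assumes A: "A \<in> tensors a b n"
    and B: "B \<in> tensors b c n" and C: "C \<in> tensors b c n" and D: "D \<in> tensors b c n"
    and n: "0 < n"
  shows "A *\<^sub>t (B +\<^sub>t C -\<^sub>t D) = A *\<^sub>t B +\<^sub>t A *\<^sub>t C -\<^sub>t A *\<^sub>t D"
proof (rule bcirc_inj[OF _ _ n])
  note BC = tplus_closed[OF B C]
  note BCD = tminus_closed[OF BC D]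
  note AB = tprod_works[OF A B n] and AC = tprod_works[OF A C n] and AD = tprod_works[OF A D n]
  note ABC = tplus_closed[OF AB(1) AC(1)]
  note mat = bcirc_carrier[OF A n] bcirc_carrier[OF B n] bcirc_carrier[OF C n] bcirc_carrier[OF D n]
  show "A *\<^sub>t (B +\<^sub>t C -\<^sub>t D) \<in> tensors a c n" by (rule tprod_works(1)[OF A BCD n])
  show "A *\<^sub>t B +\<^sub>t A *\<^sub>t C -\<^sub>t A *\<^sub>t D \<in> tensors a c n" by (rule tminus_closed[OF ABC AD(1)])
  have "bcirc A * (bcirc B + bcirc C - bcirc D) =
      bcirc A * (bcirc B + bcirc C) - bcirc A * bcirc D"
    using mat by (intro mult_minus_distrib_mat) auto
  also have "bcirc A * (bcirc B + bcirc C) = bcirc A * bcirc B + bcirc A * bcirc C"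
    using mat by (intro mult_add_distrib_mat) auto
  finally show "bcirc (A *\<^sub>t (B +\<^sub>t C -\<^sub>t D)) = bcirc (A *\<^sub>t B +\<^sub>t A *\<^sub>t C -\<^sub>t A *\<^sub>t D)"
    by (simp add: tprod_works(2)[OF A BCD n] bcirc_tminus[OF BC D n] bcirc_tplus[OF B C n]
        bcirc_tminus[OF ABC AD(1) n] bcirc_tplus[OF AB(1) AC(1) n] AB(2) AC(2) AD(2))
qed

lemma tprod_tplus_tminus_right:
  assumes A: "A \<in> tensors a b n" and B: "B \<in> tensors a b n" and C: "C \<in> tensors a b n"
    and D: "D \<in> tensors b c n" and n: "0 < n"
  shows "(A +\<^sub>t B -\<^sub>t C) *\<^sub>t D = A *\<^sub>t D +\<^sub>t B *\<^sub>t D -\<^sub>t C *\<^sub>t D"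
proof (rule bcirc_inj[OF _ _ n])
  note AB = tplus_closed[OF A B]
  note ABC = tminus_closed[OF AB C]
  note AD = tprod_works[OF A D n] and BD = tprod_works[OF B D n] and CD = tprod_works[OF C D n]
  note ABD = tplus_closed[OF AD(1) BD(1)]
  note mat = bcirc_carrier[OF A n] bcirc_carrier[OF B n] bcirc_carrier[OF C n] bcirc_carrier[OF D n]
  show "(A +\<^sub>t B -\<^sub>t C) *\<^sub>t D \<in> tensors a c n" by (rule tprod_works(1)[OF ABC D n])
  show "A *\<^sub>t D +\<^sub>t B *\<^sub>t D -\<^sub>t C *\<^sub>t D \<in> tensors a c n" by (rule tminus_closed[OF ABD CD(1)])
  have "(bcirc A + bcirc B - bcirc C) * bcirc D =
      (bcirc A + bcirc B) * bcirc D - bcirc C * bcirc D"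
    using mat by (intro minus_mult_distrib_mat) auto
  also have "(bcirc A + bcirc B) * bcirc D = bcirc A * bcirc D + bcirc B * bcirc D"
    using mat by (intro add_mult_distrib_mat) auto
  finally show "bcirc ((A +\<^sub>t B -\<^sub>t C) *\<^sub>t D) = bcirc (A *\<^sub>t D +\<^sub>t B *\<^sub>t D -\<^sub>t C *\<^sub>t D)"
    by (simp add: tprod_works(2)[OF ABC D n] bcirc_tminus[OF AB C n] bcirc_tplus[OF A B n]
        bcirc_tminus[OF ABD CD(1) n] bcirc_tplus[OF AD(1) BD(1) n] AD(2) BD(2) CD(2))
qed

lemma tplus_tminus_cancel_right:
  assumes A: "A \<in> tensors a b n" and B: "B \<in> tensors a b n" and n: "0 < n"
  shows "A +\<^sub>t B -\<^sub>t B = A"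
proof (rule bcirc_inj[OF _ A n])
  note AB = tplus_closed[OF A B]
  show "A +\<^sub>t B -\<^sub>t B \<in> tensors a b n" by (rule tminus_closed[OF AB B])
  show "bcirc (A +\<^sub>t B -\<^sub>t B) = bcirc A"
    using bcirc_carrier[OF A n] bcirc_carrier[OF B n]
    by (intro eq_matI) (auto simp: bcirc_tminus[OF AB B n] bcirc_tplus[OF A B n])
qed

lemma tplus_comm:
  assumes A: "A \<in> tensors a b n" and B: "B \<in> tensors a b n" and n: "0 < n"
  shows "A +\<^sub>t B = B +\<^sub>t A"
proof (rule bcirc_inj[OF tplus_closed[OF A B] tplus_closed[OF B A] n])
  show "bcirc (A +\<^sub>t B) = bcirc (B +\<^sub>t A)"
    using bcirc_carrier[OF A n] bcirc_carrier[OF B n]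
    by (simp add: bcirc_tplus[OF A B n] bcirc_tplus[OF B A n] comm_add_mat)
qed

section \<open>Ranges\<close>

lemma trange_eq:
  assumes A: "A \<in> tensors a b n" and n: "0 < n"
  shows "trange A = {bcirc A *\<^sub>v v | v. v \<in> carrier_vec (b * n)}"
proof -
  note A' = bcirc_carrier[OF A n]
  show ?thesis
    using A' by (auto simp: trange_def vec_space.col_space_eq[OF A'])
qed

lemma trange_tprod_subset:
  assumes A: "A \<in> tensors a b n" and B: "B \<in> tensors b c n" and n: "0 < n"
  shows "trange (A *\<^sub>t B) \<subseteq> trange A"
proof
  note A' = bcirc_carrier[OF A n] and B' = bcirc_carrier[OF B n]
  fix y assume "y \<in> trange (A *\<^sub>t B)"
  then obtain v where v: "v \<in> carrier_vec (c * n)" and y: "y = bcirc A * bcirc B *\<^sub>v v"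
    by (auto simp: trange_eq[OF tprod_works(1)[OF A B n] n] tprod_works(2)[OF A B n])
  have "y = bcirc A *\<^sub>v (bcirc B *\<^sub>v v)"
    unfolding y using A' B' v by (rule assoc_mult_mat_vec)
  moreover have "bcirc B *\<^sub>v v \<in> carrier_vec (b * n)" using B' v by auto
  ultimately show "y \<in> trange A" by (auto simp: trange_eq[OF A n])
qed

text \<open>
  Each column of \<open>bcirc B\<close> is \<open>bcirc A\<close> applied to some vector, and \<open>P * A = A\<close> means that \<open>bcirc P\<close>
  acts as the identity on such vectors.  Only a factorization of the matrix \<open>bcirc B\<close>, column by
  column, is involved; the coefficients need not form a block circulant matrix.
\<close>

lemma tprod_left_fix_range:
  assumes P: "P \<in> tensors a a n" and A: "A \<in> tensors a b n" and B: "B \<in> tensors a c n"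
    and n: "0 < n" and fix_A: "P *\<^sub>t A = A" and sub: "trange B \<subseteq> trange A"
  shows "P *\<^sub>t B = B"
proof (rule bcirc_inj[OF tprod_works(1)[OF P B n] B n])
  note P' = bcirc_carrier[OF P n] and A' = bcirc_carrier[OF A n] and B' = bcirc_carrier[OF B n]
  have PA: "bcirc P * bcirc A = bcirc A" using tprod_works(2)[OF P A n] unfolding fix_A by (rule sym)
  have "bcirc P * bcirc B = bcirc B"
  proof (rule mat_col_eqI)
    fix j assume "j < dim_col (bcirc B)"
    then have j: "j < c * n" using B' by simp
    have "col (bcirc B) j = bcirc B *\<^sub>v unit_vec (c * n) j"
      using B' j by (intro eq_vecI) auto
    then have "col (bcirc B) j \<in> trange B"
      by (auto simp: trange_eq[OF B n])
    then obtain v where v: "v \<in> carrier_vec (b * n)" and Bj: "col (bcirc B) j = bcirc A *\<^sub>v v"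
      using sub by (auto simp: trange_eq[OF A n])
    have "col (bcirc P * bcirc B) j = bcirc P *\<^sub>v col (bcirc B) j"
      using P' B' j by (intro col_mult2) auto
    also have "\<dots> = bcirc P * bcirc A *\<^sub>v v"
      unfolding Bj using P' A' v by (rule assoc_mult_mat_vec[symmetric])
    also have "\<dots> = col (bcirc B) j" unfolding PA Bj ..
    finally show "col (bcirc P * bcirc B) j = col (bcirc B) j" .
  qed (use P' B' in auto)
  then show "bcirc (P *\<^sub>t B) = bcirc B" by (simp add: tprod_works(2)[OF P B n])
qed

section \<open>Outer inverses with prescribed range\<close>

text \<open>
  The quadratic equation \<open>X * S * X = X\<close> becomes linear in \<open>X\<close>: when \<open>X\<close> and \<open>T\<close> have the same range,
  \<open>X * S\<close> fixes \<open>X\<close> if and only if it fixes \<open>T\<close>.  Half of the range equality follows from the linear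
  equation, which reads \<open>T = X * (S * T)\<close>.
\<close>

lemma inverses_2_range_iff:
  assumes n: "0 < n" and S: "S \<in> tensors p q n" and T: "T \<in> tensors q k n"
  shows "X \<in> inverses_2_range S T \<longleftrightarrow>
    X \<in> tensors q p n \<and> X *\<^sub>t S *\<^sub>t T = T \<and> trange X \<subseteq> trange T"
proof (cases "X \<in> tensors q p n")
  case X: True
  note XS = tprod_works(1)[OF X S n] and ST = tprod_works(1)[OF S T n]
  have "X *\<^sub>t S *\<^sub>t X = X \<and> trange X = trange T \<longleftrightarrow>
    X *\<^sub>t S *\<^sub>t T = T \<and> trange X \<subseteq> trange T" (is "?l \<longleftrightarrow> ?r")
  proof
    assume ?l
    then show ?r using tprod_left_fix_range[OF XS X T n] by simp
  next
    assume r: ?r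
    then have "trange T \<subseteq> trange X"
      using trange_tprod_subset[OF X ST n] by (simp add: tprod_assoc[OF X S T n, symmetric])
    with r show ?l using tprod_left_fix_range[OF XS T X n] by simp
  qed
  then show ?thesis using X by (simp add: inverses_2_range_def tensors_size[OF S n])
qed (simp add: inverses_2_range_def tensors_size[OF S n])

lemma inverses_2_range_eq_products:
  assumes n: "0 < n" and S: "S \<in> tensors p q n" and T: "T \<in> tensors q k n"
    and G: "G \<in> tensors k p n" and fix_T: "T *\<^sub>t G *\<^sub>t S *\<^sub>t T = T"
  shows "inverses_2_range S T = {T *\<^sub>t Z | Z. Z \<in> tensors k p n \<and> T *\<^sub>t Z *\<^sub>t S *\<^sub>t T = T}"
    (is "_ = ?R")
proof
  show "?R \<subseteq> inverses_2_range S T"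
    using tprod_works(1)[OF T _ n] trange_tprod_subset[OF T _ n]
    by (auto simp: inverses_2_range_iff[OF n S T])
  show "inverses_2_range S T \<subseteq> ?R"
  proof
    fix X assume "X \<in> inverses_2_range S T"
    then have X: "X \<in> tensors q p n" and XST: "X *\<^sub>t S *\<^sub>t T = T" and sub: "trange X \<subseteq> trange T"
      by (auto simp: inverses_2_range_iff[OF n S T])
    note TG = tprod_works(1)[OF T G n] and SX = tprod_works(1)[OF S X n]
    note GSX = tprod_works(1)[OF G SX n]
    define Z where "Z = G *\<^sub>t (S *\<^sub>t X)"
    have "T *\<^sub>t Z = T *\<^sub>t G *\<^sub>t S *\<^sub>t X"
      unfolding Z_def by (simp only: tprod_assoc[OF TG S X n] tprod_assoc[OF T G SX n])
    also have "\<dots> = X"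
      by (rule tprod_left_fix_range[OF tprod_works(1)[OF TG S n] T X n fix_T sub])
    finally have TZ: "T *\<^sub>t Z = X" .
    have "Z \<in> tensors k p n" unfolding Z_def by (rule GSX)
    moreover have "T *\<^sub>t Z *\<^sub>t S *\<^sub>t T = T" unfolding TZ by (rule XST)
    ultimately show "X \<in> ?R" using TZ[symmetric] by blast
  qed
qed

text \<open>
  Multiplying by \<open>S\<close> on the left cannot lose information about \<open>T * Z * S * T = T\<close>, because \<open>T * G\<close>
  recovers \<open>T\<close> from \<open>S * T\<close>.
\<close>

lemma inverses_1_iff:
  assumes n: "0 < n" and S: "S \<in> tensors p q n" and T: "T \<in> tensors q k n"
    and G: "G \<in> tensors k p n" and fix_T: "T *\<^sub>t G *\<^sub>t S *\<^sub>t T = T"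
  shows "Z \<in> inverses_1 (S *\<^sub>t T) \<longleftrightarrow> Z \<in> tensors k p n \<and> T *\<^sub>t Z *\<^sub>t S *\<^sub>t T = T"
proof -
  note ST = tprod_works(1)[OF S T n] and TG = tprod_works(1)[OF T G n]
  note TGS = tprod_works(1)[OF TG S n]
  have "S *\<^sub>t T *\<^sub>t Z *\<^sub>t (S *\<^sub>t T) = S *\<^sub>t T \<longleftrightarrow> T *\<^sub>t Z *\<^sub>t S *\<^sub>t T = T"
    if Z: "Z \<in> tensors k p n"
  proof -
    note TZ = tprod_works(1)[OF T Z n]
    note TZS = tprod_works(1)[OF TZ S n]
    note TZST = tprod_works(1)[OF TZS T n]
    have l: "S *\<^sub>t T *\<^sub>t Z *\<^sub>t (S *\<^sub>t T) = S *\<^sub>t (T *\<^sub>t Z *\<^sub>t S *\<^sub>t T)"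
      by (simp add: tprod_assoc[OF S T Z n] tprod_assoc[OF S TZ ST n] tprod_assoc[OF TZ S T n])
    have TZST_fixed: "T *\<^sub>t G *\<^sub>t (S *\<^sub>t (T *\<^sub>t Z *\<^sub>t S *\<^sub>t T)) = T *\<^sub>t Z *\<^sub>t S *\<^sub>t T"
    proof -
      note ZST = tprod_works(1)[OF Z ST n]
      have e: "T *\<^sub>t Z *\<^sub>t S *\<^sub>t T = T *\<^sub>t (Z *\<^sub>t (S *\<^sub>t T))"
        by (simp add: tprod_assoc[OF TZ S T n] tprod_assoc[OF T Z ST n])
      have "T *\<^sub>t G *\<^sub>t (S *\<^sub>t (T *\<^sub>t Z *\<^sub>t S *\<^sub>t T)) = T *\<^sub>t G *\<^sub>t S *\<^sub>t (T *\<^sub>t Z *\<^sub>t S *\<^sub>t T)"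
        by (rule tprod_assoc[OF TG S TZST n, symmetric])
      also have "\<dots> = T *\<^sub>t G *\<^sub>t S *\<^sub>t T *\<^sub>t (Z *\<^sub>t (S *\<^sub>t T))"
        unfolding e by (rule tprod_assoc[OF TGS T ZST n, symmetric])
      finally show ?thesis by (simp add: fix_T e)
    qed
    have TG_ST: "T *\<^sub>t G *\<^sub>t (S *\<^sub>t T) = T"
      using tprod_assoc[OF TG S T n, symmetric] fix_T by simp
    show ?thesis unfolding l using TZST_fixed TG_ST by metis
  qed
  then show ?thesis by (auto simp: inverses_1_def tensors_size[OF ST n])
qed

text \<open>
  The tensor \<open>T * G + T * Z - T * Z * S * T * G\<close> is \<open>T * W\<close> for \<open>W = G + Z - Z * S * T * G\<close>.  In
  \<open>T * W * S * T\<close> the two terms with \<open>Z\<close> cancel, since \<open>T * G * S * T = T\<close>; so \<open>W\<close> solves the equation.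
  Conversely, if \<open>Z\<close> solves it, then \<open>T * Z * S * T * G = T * G\<close>, and the formula returns \<open>T * Z\<close>.
\<close>

lemma products_eq_parametrization:
  assumes n: "0 < n" and S: "S \<in> tensors p q n" and T: "T \<in> tensors q k n"
    and G: "G \<in> tensors k p n" and fix_T: "T *\<^sub>t G *\<^sub>t S *\<^sub>t T = T"
  shows "{T *\<^sub>t Z | Z. Z \<in> tensors k p n \<and> T *\<^sub>t Z *\<^sub>t S *\<^sub>t T = T} =
    {T *\<^sub>t G +\<^sub>t T *\<^sub>t Z -\<^sub>t T *\<^sub>t Z *\<^sub>t S *\<^sub>t T *\<^sub>t G | Z. Z \<in> tensors k p n}" (is "?L = ?R")
proof
  note TG = tprod_works(1)[OF T G n] and ST = tprod_works(1)[OF S T n]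
  show "?L \<subseteq> ?R"
  proof
    fix X assume "X \<in> ?L"
    then obtain Z where Z: "Z \<in> tensors k p n" and fix_Z: "T *\<^sub>t Z *\<^sub>t S *\<^sub>t T = T"
      and X: "X = T *\<^sub>t Z" by blast
    note TZ = tprod_works(1)[OF T Z n]
    have "T *\<^sub>t G +\<^sub>t T *\<^sub>t Z -\<^sub>t T *\<^sub>t Z *\<^sub>t S *\<^sub>t T *\<^sub>t G = X"
      unfolding fix_Z X tplus_comm[OF TG TZ n] by (rule tplus_tminus_cancel_right[OF TZ TG n])
    then show "X \<in> ?R" using Z by blast
  qed
  show "?R \<subseteq> ?L"
  proof
    fix X assume "X \<in> ?R"
    then obtain Z where Z: "Z \<in> tensors k p n"
      and X: "X = T *\<^sub>t G +\<^sub>t T *\<^sub>t Z -\<^sub>t T *\<^sub>t Z *\<^sub>t S *\<^sub>t T *\<^sub>t G" by blast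
    define W where "W = G +\<^sub>t Z -\<^sub>t Z *\<^sub>t (S *\<^sub>t T) *\<^sub>t G"
    note TZ = tprod_works(1)[OF T Z n] and ZST = tprod_works(1)[OF Z ST n]
    note TZS = tprod_works(1)[OF TZ S n] and ZSTG = tprod_works(1)[OF ZST G n]
    note TZST = tprod_works(1)[OF TZS T n]
    note TZSTG = tprod_works(1)[OF TZST G n]
    have W: "W \<in> tensors k p n"
      unfolding W_def by (rule tminus_closed[OF tplus_closed[OF G Z] ZSTG])
    note TW = tprod_works(1)[OF T W n]
    have "T *\<^sub>t (Z *\<^sub>t (S *\<^sub>t T) *\<^sub>t G) = T *\<^sub>t Z *\<^sub>t S *\<^sub>t T *\<^sub>t G"
      by (simp add: tprod_assoc[OF T ZST G n, symmetric] tprod_assoc[OF T Z ST n, symmetric]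
          tprod_assoc[OF TZ S T n])
    then have X_eq: "X = T *\<^sub>t W"
      unfolding X W_def tprod_tplus_tminus_left[OF T G Z ZSTG n] by simp
    have TG_ST: "T *\<^sub>t G *\<^sub>t (S *\<^sub>t T) = T"
      using tprod_assoc[OF TG S T n, symmetric] fix_T by simp
    have TZ_ST: "T *\<^sub>t Z *\<^sub>t (S *\<^sub>t T) = T *\<^sub>t Z *\<^sub>t S *\<^sub>t T"
      by (rule tprod_assoc[OF TZ S T n, symmetric])
    have "T *\<^sub>t Z *\<^sub>t S *\<^sub>t T *\<^sub>t G *\<^sub>t (S *\<^sub>t T) = T *\<^sub>t Z *\<^sub>t S *\<^sub>t (T *\<^sub>t G *\<^sub>t (S *\<^sub>t T))"
      by (simp add: tprod_assoc[OF TZS T G n] tprod_assoc[OF TZS TG ST n])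
    then have defect: "T *\<^sub>t Z *\<^sub>t S *\<^sub>t T *\<^sub>t G *\<^sub>t (S *\<^sub>t T) = T *\<^sub>t Z *\<^sub>t S *\<^sub>t T"
      by (simp add: TG_ST)
    have "T *\<^sub>t W *\<^sub>t S *\<^sub>t T = X *\<^sub>t (S *\<^sub>t T)"
      unfolding X_eq by (rule tprod_assoc[OF TW S T n])
    also have "\<dots> = T +\<^sub>t T *\<^sub>t Z *\<^sub>t S *\<^sub>t T -\<^sub>t T *\<^sub>t Z *\<^sub>t S *\<^sub>t T"
      unfolding X tprod_tplus_tminus_right[OF TG TZ TZSTG ST n] TG_ST TZ_ST defect ..
    also have "\<dots> = T" by (rule tplus_tminus_cancel_right[OF T TZST n])
    finally show "X \<in> ?L" using X_eq W by blast
  qed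
qed

theorem theorem3p5:
  fixes S T G :: tensor and p q k n :: nat
  assumes n: "n > 0"
    and S: "S \<in> tensors p q n"
    and T: "T \<in> tensors q k n"
    and G: "G \<in> inverses_1 (S *\<^sub>t T)"
    and a: "\<exists>X \<in> tensors q p n. X *\<^sub>t S *\<^sub>t X = X \<and> trange X = trange T"
    and b: "\<exists>Z \<in> tensors k p n. T = T *\<^sub>t Z *\<^sub>t S *\<^sub>t T"
    and c: "tnull T = tnull (S *\<^sub>t T)"
    and d: "T = T *\<^sub>t G *\<^sub>t S *\<^sub>t T"
    and e: "trank (S *\<^sub>t T) = trank T"
  shows "inverses_2_range S T = {T *\<^sub>t Y | Y. Y \<in> inverses_1 (S *\<^sub>t T)}
    \<and> inverses_2_range S T = {T *\<^sub>t Z | Z. Z \<in> tensors k p n \<and> T *\<^sub>t Z *\<^sub>t S *\<^sub>t T = T}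
    \<and> inverses_2_range S T =
        {T *\<^sub>t G +\<^sub>t T *\<^sub>t Z -\<^sub>t T *\<^sub>t Z *\<^sub>t S *\<^sub>t T *\<^sub>t G | Z. Z \<in> tensors k p n}"
proof -
  have G': "G \<in> tensors k p n"
    using G tensors_size[OF tprod_works(1)[OF S T n] n] by (simp add: inverses_1_def)
  note hyps = n S T G' d[symmetric]
  show ?thesis
    using inverses_2_range_eq_products[OF hyps] products_eq_parametrization[OF hyps]
    by (simp add: inverses_1_iff[OF hyps])
qed

end
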